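(* Let $f_1,\dots,f_s\in\mathbb K\llbracket x\rrbracket$ be monic series of positive order and let $R=\mathbb K\llbracket f_1,\dots,f_s\rrbracket$, where the integral closure of $R$ in its quotient field is $\mathbb K\llbracket x\rrbracket$ and $\mathbb K\llbracket x\rrbracket/R$ has finite length as an $R$-module. Let $\phi:\mathbb K[X_1,\dots,X_s]\to\mathbb K[x]$ be the $\mathbb K$-algebra homomorphism with $\phi(X_i)=\mathrm M_{\mathrm o}(f_i)$ for all $i$, and let $F_1,\dots,F_r$ be binomials $F_i=X_1^{\alpha^i_1}\cdots X_s^{\alpha^i_s}-X_1^{\beta^i_1}\cdots X_s^{\beta^i_s}$ generating $\ker\phi$. Put $S_i=f_1^{\alpha^i_1}\cdots f_s^{\alpha^i_s}-f_1^{\beta^i_1}\cdots f_s^{\beta^i_s}$, and for each $i$ let $\mathrm R_{\mathrm o}(S_i,\{f_1,\dots,f_s\})$ be a remainder of $S_i$ obtained by the division process (with any choice of the exponents used in the process). Then $\{f_1,\dots,f_s\}$ is a basis of $R$ if and only if $\mathrm R_{\mathrm o}(S_i,\{f_1,\dots,f_s\})=0$ for all $i\in\{1,\dots,r\}$.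
   Context: $\mathbb K$ is a field and $\mathbb N$ includes $0$. For nonzero $\varphi=\sum_i c_ix^i\in\mathbb K\llbracket x\rrbracket$, $\mathrm o(\varphi)=\min\{i\mid c_i\neq0\}$ and $\mathrm M_{\mathrm o}(\varphi)=c_{\mathrm o(\varphi)}x^{\mathrm o(\varphi)}$; $\varphi$ is monic if $\mathrm M_{\mathrm o}(\varphi)=x^{\mathrm o(\varphi)}$; $\mathrm o(0)=+\infty$. For series of positive order, $\mathbb K\llbracket f_1,\dots,f_s\rrbracket=\{P(f_1,\dots,f_s)\mid P\in\mathbb K\llbracket X_1,\dots,X_s\rrbracket\}$. $\mathrm o(R)=\{\mathrm o(f)\mid f\in R\setminus\{0\}\}$, and $\langle B\rangle$ is the submonoid of $\mathbb N$ generated by $B$. The set $\{f_1,\dots,f_s\}$ is a basis of $R$ if $\mathrm o(R)=\langle \mathrm o(f_1),\dots,\mathrm o(f_s)\rangle$. Division process: given $f\in\mathbb K\llbracket x\rrbracket$, put $f^0=f$. For $k\ge0$, if $f^k=0$ stop (all later terms are $0$). Otherwise let $p=\mathrm o(f^k)$ and $\mathrm M_{\mathrm o}(f^k)=c_px^p$. If $p\notin\langle \mathrm o(f_1),\dots,\mathrm o(f_s)\rangle$, set $g^{k+1}=0$, $r^{k+1}=c_px^p$. If $p\in\langle \mathrm o(f_1),\dots,\mathrm o(f_s)\rangle$, choose $\underline\theta\in\mathbb N^s$ with $\sum_i\theta_i\mathrm o(f_i)=p$ and $c\in\mathbb K$ with $c_px^p=c\,\mathrm M_{\mathrm o}(f_1)^{\theta_1}\cdots\mathrm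 M_{\mathrm o}(f_s)^{\theta_s}$, and set $g^{k+1}=c f_1^{\theta_1}\cdots f_s^{\theta_s}$, $r^{k+1}=0$. In both cases $f^{k+1}=f^k-g^{k+1}-r^{k+1}$. The orders of the $f^k$ strictly increase, so $g=\sum_k g^k\in R$ and $r=\sum_k r^k$ converge and $f=g+r$. The series $r$ is denoted $\mathrm R_{\mathrm o}(f,\{f_1,\dots,f_s\})$; in general it depends on the choices of $\underline\theta$. *)

theory Defs
  imports
    "HOL-Analysis.Infinite_Sum"
    "HOL-Computational_Algebra.Computational_Algebra"
    "HOL-Library.Poly_Mapping"
    "HOL-Library.Extended_Nat"
    "HOL-Algebra.Module"
    "HOL-Algebra.AbelCoset"
begin

text \<open>
  The series \<open>f\<^sub>1, \<dots>, f\<^sub>s\<close> are a family indexed by a finite type \<open>'n\<close> with \<open>s = CARD('n)\<close>.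
  Exponent vectors are elements of \<^typ>\<open>'n \<Rightarrow>\<^sub>0 nat\<close>, and \<open>K[X\<^sub>1, \<dots>, X\<^sub>s]\<close> is the monoid algebra
  \<^typ>\<open>('n \<Rightarrow>\<^sub>0 nat) \<Rightarrow>\<^sub>0 'a\<close>, whose multiplication is convolution. The order of a nonzero
  power series is \<^const>\<open>subdegree\<close>; since \<^term>\<open>subdegree 0 = 0\<close>, the zero series
  is always treated separately.
\<close>


subsection \<open>Leading monomials and orders\<close>

definition lead_monom :: "'a::field fps \<Rightarrow> 'a poly" where
  "lead_monom h = monom (fps_nth h (subdegree h)) (subdegree h)"

definition monic_fps :: "'a::field fps \<Rightarrow> bool" where
  "monic_fps h \<longleftrightarrow> h \<noteq> 0 \<and> lead_monom h = monom 1 (subdegree h)"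

definition order_set :: "'a::field fps set \<Rightarrow> nat set" where
  "order_set R = subdegree ` (R - {0})"

inductive_set gen_submonoid :: "nat set \<Rightarrow> nat set" for B :: "nat set" where
  zero: "0 \<in> gen_submonoid B"
| incl: "b \<in> B \<Longrightarrow> b \<in> gen_submonoid B"
| add: "m \<in> gen_submonoid B \<Longrightarrow> n \<in> gen_submonoid B \<Longrightarrow> m + n \<in> gen_submonoid B"


subsection \<open>The algebra of power series in a family\<close>

definition power_prod :: "('n::finite \<Rightarrow> 'b::comm_monoid_mult) \<Rightarrow> ('n \<Rightarrow>\<^sub>0 nat) \<Rightarrow> 'b" where
  "power_prod f \<theta> = (\<Prod>i\<in>UNIV. f i ^ Poly_Mapping.lookup \<theta> i)"

text \<open>
  A formal power series \<open>P\<close> in \<open>X\<^sub>1, \<dots>, X\<^sub>s\<close> is given by its coefficient function; its value at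
  \<open>f\<close> is the sum of the terms \<open>P\<^sub>\<theta> f\<^sup>\<theta>\<close> in the \<open>x\<close>-adic topology, which is the topology of the
  type \<^typ>\<open>'a fps\<close>. The sum exists for every \<open>P\<close> if all \<open>f\<^sub>i\<close> have positive order.
\<close>

definition fps_algebra :: "('n::finite \<Rightarrow> 'a::field fps) \<Rightarrow> 'a fps set" where
  "fps_algebra f =
    {h. \<exists>P :: ('n \<Rightarrow>\<^sub>0 nat) \<Rightarrow> 'a. ((\<lambda>\<theta>. fps_const (P \<theta>) * power_prod f \<theta>) has_sum h) UNIV}"

definition is_basis :: "('n::finite \<Rightarrow> 'a::field fps) \<Rightarrow> 'a fps set \<Rightarrow> bool" where
  "is_basis f R \<longleftrightarrow> order_set R = gen_submonoid (range (\<lambda>i. subdegree (f i)))"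


subsection \<open>Integral closure in the quotient field\<close>

text \<open>
  The quotient field of a subring of \<open>K[[x]]\<close> is formed inside the field \<open>K((x))\<close> of
  Laurent series.
\<close>

definition quotient_field :: "'a::field fps set \<Rightarrow> 'a fls set" where
  "quotient_field R = {fps_to_fls a / fps_to_fls b | a b. a \<in> R \<and> b \<in> R \<and> b \<noteq> 0}"

definition integral_closure :: "'b::field set \<Rightarrow> 'b set \<Rightarrow> 'b set" where
  "integral_closure A L =
    {z \<in> L. \<exists>p :: 'b poly. lead_coeff p = 1 \<and> (\<forall>i. coeff p i \<in> A) \<and> poly p z = 0}"


subsection \<open>Length of modules\<close>

definition module_length :: "('r, 'k) ring_scheme \<Rightarrow> ('r, 'm, 'l) module_scheme \<Rightarrow> enat" where
  "module_length R M =
    Sup {enat n | n. \<exists>C. (\<forall>i\<le>n. submodule (C i) R M) \<and> (\<forall>i<n. C i \<subset> C (Suc i))}"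

text \<open>
  In the quotient module, \<open>a (x + N) = a x + N\<close> is written as the set sum \<open>N + a (x + N)\<close>. The
  ring fields \<open>mult\<close> and \<open>one\<close> of a module record play no role.
\<close>

definition quotient_module :: "('r, 'm) module \<Rightarrow> 'm set \<Rightarrow> ('r, 'm set) module" where
  "quotient_module M N =
    \<lparr>carrier = a_rcosets\<^bsub>M\<^esub> N, mult = undefined, one = undefined, zero = N, add = set_add M,
     smult = (\<lambda>a X. N <+>\<^bsub>M\<^esub> ((\<lambda>x. a \<odot>\<^bsub>M\<^esub> x) ` X))\<rparr>"

definition ring_on :: "'b::comm_ring_1 set \<Rightarrow> 'b ring" where
  "ring_on A = \<lparr>carrier = A, mult = (*), one = 1, zero = 0, add = (+)\<rparr>"

text \<open>The ambient commutative ring as a module over any of its subrings.\<close>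

definition ambient_module :: "('b::comm_ring_1, 'b) module" where
  "ambient_module =
    \<lparr>carrier = UNIV, mult = (*), one = 1, zero = 0, add = (+), smult = (*)\<rparr>"


subsection \<open>Polynomials in several variables\<close>

definition poly_var :: "'n \<Rightarrow> (('n \<Rightarrow>\<^sub>0 nat) \<Rightarrow>\<^sub>0 'a::field)" where
  "poly_var i = Poly_Mapping.single (Poly_Mapping.single i 1) 1"

definition algebra_hom :: "((('n \<Rightarrow>\<^sub>0 nat) \<Rightarrow>\<^sub>0 'a::field) \<Rightarrow> 'a poly) \<Rightarrow> bool" where
  "algebra_hom \<phi> \<longleftrightarrow>
    \<phi> 1 = 1 \<and> (\<forall>p q. \<phi> (p + q) = \<phi> p + \<phi> q) \<and> (\<forall>p q. \<phi> (p * q) = \<phi> p * \<phi> q) \<and>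
    (\<forall>c p. \<phi> (Poly_Mapping.single 0 c * p) = Polynomial.smult c (\<phi> p))"

text \<open>The ideal generated by a set is its span in the ring regarded as a module over itself.\<close>

definition gen_ideal :: "'b::comm_ring_1 set \<Rightarrow> 'b set" where
  "gen_ideal B = module.span (*) B"


subsection \<open>The division process\<close>

text \<open>
  \<open>division_step f h g r\<close>: the pair \<open>(g, r)\<close> is a legitimate choice of \<open>(g\<^sup>k\<^sup>+\<^sup>1, r\<^sup>k\<^sup>+\<^sup>1)\<close> when
  \<open>f\<^sup>k = h\<close>.
\<close>

definition division_step ::
    "('n::finite \<Rightarrow> 'a::field fps) \<Rightarrow> 'a fps \<Rightarrow> 'a fps \<Rightarrow> 'a fps \<Rightarrow> bool" where
  "division_step f h g r \<longleftrightarrow>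
    (if h = 0 then g = 0 \<and> r = 0
     else if subdegree h \<notin> gen_submonoid (range (\<lambda>i. subdegree (f i)))
     then g = 0 \<and> r = fps_of_poly (lead_monom h)
     else r = 0 \<and>
       (\<exists>\<theta> c. (\<Sum>i\<in>UNIV. Poly_Mapping.lookup \<theta> i * subdegree (f i)) = subdegree h \<and>
          lead_monom h = Polynomial.smult c (power_prod (\<lambda>i. lead_monom (f i)) \<theta>) \<and>
          g = fps_const c * power_prod f \<theta>))"

text \<open>
  \<open>is_remainder f h r\<close>: some run of the division process, for some choice of the exponents,
  produces the remainder \<open>r\<close> of \<open>h\<close>.
\<close>

definition is_remainder :: "('n::finite \<Rightarrow> 'a::field fps) \<Rightarrow> 'a fps \<Rightarrow> 'a fps \<Rightarrow> bool" where
  "is_remainder f h r \<longleftrightarrow>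
    (\<exists>hs gs rs. hs 0 = h \<and>
       (\<forall>k. division_step f (hs k) (gs (Suc k)) (rs (Suc k)) \<and>
            hs (Suc k) = hs k - gs (Suc k) - rs (Suc k)) \<and>
       (\<lambda>k. rs (Suc k)) sums r)"

end

theory Submission
  imports Defs
begin

text \<open>
  Give \<open>X\<^sub>i\<close> the weight \<open>o(f\<^sub>i)\<close>, so that \<open>f\<^sup>\<theta>\<close> has order equal to the weight of \<open>\<theta>\<close>. If the
  \<open>f\<^sub>i\<close> form a basis, every order met while dividing \<open>S\<^sub>i \<in> R\<close> lies in the semigroup, so no
  remainder is ever produced. Conversely, let all remainders vanish and let \<open>h \<in> R\<close> have order
  \<open>p\<close>. Modulo \<open>x\<^sup>p\<^sup>+\<^sup>1\<close>, \<open>h\<close> is a polynomial in the \<open>f\<^sub>i\<close> with terms of weight at least some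
  \<open>q\<close>. If \<open>q < p\<close>, the leading terms of weight \<open>q\<close> cancel, so the component of weight \<open>q\<close> is a
  relation in \<open>ker \<phi>\<close>, that is, a combination of the weighted homogeneous binomials \<open>F\<^sub>i\<close>. Its
  value at \<open>f\<close> is a combination of the \<open>S\<^sub>i\<close>, and dividing \<open>S\<^sub>i\<close> without remainder rewrites it
  with terms of weight greater than \<open>q\<close>. Hence \<open>q\<close> can be raised to \<open>p\<close>, and a term of weight
  exactly \<open>p\<close> must occur. Working modulo \<open>x\<^sup>p\<^sup>+\<^sup>1\<close> makes all sums finite.
\<close>

section \<open>Weights of power products\<close>

definition weight :: "('n::finite \<Rightarrow> 'a::field fps) \<Rightarrow> ('n \<Rightarrow>\<^sub>0 nat) \<Rightarrow> nat" where
  "weight f \<theta> = (\<Sum>i\<in>UNIV. Poly_Mapping.lookup \<theta> i * subdegree (f i))"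

lemma weight_add: "weight f (\<theta> + \<eta>) = weight f \<theta> + weight f \<eta>"
  by (simp add: weight_def lookup_add sum.distrib algebra_simps)

lemma weight_zero [simp]: "weight f 0 = 0"
  by (simp add: weight_def)

lemma weight_single: "weight f (Poly_Mapping.single i n) = n * subdegree (f i)"
proof -
  have "weight f (Poly_Mapping.single i n) = (\<Sum>j\<in>UNIV. if j = i then n * subdegree (f i) else 0)"
    unfolding weight_def by (intro sum.cong) (auto simp: lookup_single when_def)
  then show ?thesis by simp
qed

lemma power_prod_add: "power_prod f (\<theta> + \<eta>) = power_prod f \<theta> * power_prod f \<eta>"
  by (simp add: power_prod_def lookup_add power_add prod.distrib)

lemma weight_in_gen_submonoid: "weight f \<theta> \<in> gen_submonoid (range (\<lambda>i. subdegree (f i)))"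
proof -
  let ?G = "gen_submonoid (range (\<lambda>i. subdegree (f i)))"
  have mult: "n * subdegree (f i) \<in> ?G" for i n
    by (induction n) (auto intro: gen_submonoid.intros)
  have "(\<Sum>i\<in>I. Poly_Mapping.lookup \<theta> i * subdegree (f i)) \<in> ?G" if "finite I" for I
    using that by (induction I) (auto intro: gen_submonoid.intros mult)
  then show ?thesis by (simp add: weight_def)
qed

text \<open>Adding exponent vectors adds weights, so the weights form a monoid containing the
  generators. Membership in the semigroup thus always comes with an exponent vector.\<close>

lemma gen_submonoid_eq_range_weight:
  "gen_submonoid (range (\<lambda>i. subdegree (f i))) = range (weight f)"
proof
  show "gen_submonoid (range (\<lambda>i. subdegree (f i))) \<subseteq> range (weight f)"
  proof
    fix n assume "n \<in> gen_submonoid (range (\<lambda>i. subdegree (f i)))"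
    then show "n \<in> range (weight f)"
    proof induction
      case zero
      show ?case by (rule range_eqI[of _ _ 0]) simp
    next
      case (incl b)
      then obtain i where "b = subdegree (f i)" by blast
      then show ?case by (intro range_eqI[of _ _ "Poly_Mapping.single i 1"]) (simp add: weight_single)
    next
      case (add m n)
      then obtain \<theta> \<eta> where "m = weight f \<theta>" "n = weight f \<eta>" by blast
      then show ?case by (intro range_eqI[of _ _ "\<theta> + \<eta>"]) (simp add: weight_add)
    qed
  qed
qed (auto intro: weight_in_gen_submonoid)

text \<open>Updating at a key outside the support is the same as adding a monomial.\<close>

lemma poly_mapping_induct_single [case_names zero add]:
  assumes "P 0" "\<And>k v p. P p \<Longrightarrow> P (Poly_Mapping.single k v + p)"
  shows "P p"
proof (induction p rule: update_induct)
  case (update p k v)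
  have "Poly_Mapping.update k v p = Poly_Mapping.single k v + p"
    by (rule poly_mapping_eqI)
      (use update in \<open>auto simp: lookup_update lookup_add lookup_single in_keys_iff when_def\<close>)
  with update show ?case by (simp add: assms(2))
qed (rule assms(1))

text \<open>Scalars are constants from the field, so spans below are linear over K and not over
  K[[x]].\<close>

interpretation fps_space: Modules.module "\<lambda>c (h :: 'a::field fps). fps_const c * h"
  by unfold_locales (simp_all add: algebra_simps flip: fps_const_add fps_const_mult)

section \<open>Leading terms of power products of monic series\<close>

locale monic_family =
  fixes f :: "'n::finite \<Rightarrow> 'a::field fps"
  assumes monic: "\<And>i. monic_fps (f i)"
begin

lemma nonzero: "f i \<noteq> 0"
  using monic[of i] by (simp add: monic_fps_def)

lemma lead_monom_family: "lead_monom (f i) = monom 1 (subdegree (f i))"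
  using monic[of i] by (simp add: monic_fps_def)

lemma nth_subdegree: "fps_nth (f i) (subdegree (f i)) = 1"
  using lead_monom_family[of i] by (simp add: lead_monom_def)

text \<open>Orders add and leading coefficients multiply because a field has no zero divisors. The
  three claims share one induction, since adding a factor uses the order and leading coefficient of
  the partial product.\<close>

lemma power_prod_lead:
  shows power_prod_nonzero: "power_prod f \<theta> \<noteq> 0"
    and subdegree_power_prod: "subdegree (power_prod f \<theta>) = weight f \<theta>"
    and nth_power_prod_weight: "fps_nth (power_prod f \<theta>) (weight f \<theta>) = 1"
proof -
  let ?e = "Poly_Mapping.lookup \<theta>"
  have pow: "fps_nth (f i ^ n) (n * subdegree (f i)) = 1" for i n
  proof (induction n)
    case (Suc n)
    then show ?case
      using nth_subdegree_mult[of "f i" "f i ^ n"] by (simp add: nth_subdegree)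
  qed simp
  have "(\<Prod>i\<in>I. f i ^ ?e i) \<noteq> 0 \<and>
      subdegree (\<Prod>i\<in>I. f i ^ ?e i) = (\<Sum>i\<in>I. ?e i * subdegree (f i)) \<and>
      fps_nth (\<Prod>i\<in>I. f i ^ ?e i) (\<Sum>i\<in>I. ?e i * subdegree (f i)) = 1" if "finite I" for I
    using that
  proof induction
    case empty
    then show ?case by simp
  next
    case (insert i I)
    then have "fps_nth (f i ^ ?e i * (\<Prod>i\<in>I. f i ^ ?e i))
        (subdegree (f i ^ ?e i) + subdegree (\<Prod>i\<in>I. f i ^ ?e i)) = 1"
      using pow[of i "?e i"] by (subst nth_subdegree_mult) simp
    with insert show ?case by (simp add: nonzero)
  qed
  from this[of UNIV] show "power_prod f \<theta> \<noteq> 0" "subdegree (power_prod f \<theta>) = weight f \<theta>"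
    "fps_nth (power_prod f \<theta>) (weight f \<theta>) = 1"
    by (simp_all add: power_prod_def weight_def)
qed

lemma nth_power_prod_less_weight: "n < weight f \<theta> \<Longrightarrow> fps_nth (power_prod f \<theta>) n = 0"
  by (simp add: nth_less_subdegree_zero subdegree_power_prod)

lemma power_prod_lead_monom: "power_prod (\<lambda>i. lead_monom (f i)) \<theta> = monom 1 (weight f \<theta>)"
proof -
  have "(\<Prod>i\<in>I. monom (1::'a) (subdegree (f i)) ^ Poly_Mapping.lookup \<theta> i) =
      monom 1 (\<Sum>i\<in>I. Poly_Mapping.lookup \<theta> i * subdegree (f i))" if "finite I" for I
    using that by induction (simp_all add: monom_power mult_monom ac_simps)
  then show ?thesis by (simp add: power_prod_def lead_monom_family weight_def)
qed


section \<open>The weight filtration\<close>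

text \<open>Only finite combinations are allowed: these are values of polynomials at
  \<open>f\<close>. Cancellation may give an element of \<open>filt q\<close> an order above
  \<open>q\<close> without placing it in \<open>filt (Suc q)\<close>.\<close>

definition filt :: "nat \<Rightarrow> 'a fps set" where
  "filt q = fps_space.span {power_prod f \<theta> |\<theta>. q \<le> weight f \<theta>}"

text \<open>This is \<open>filt q\<close> modulo x^(N+1), where series in the family become
  polynomials.\<close>

definition approx :: "nat \<Rightarrow> nat \<Rightarrow> 'a fps set" where
  "approx q N = {h. \<exists>u\<in>filt q. \<forall>n\<le>N. fps_nth h n = fps_nth u n}"

lemma power_prod_in_filt: "q \<le> weight f \<theta> \<Longrightarrow> power_prod f \<theta> \<in> filt q"
  unfolding filt_def by (rule fps_space.span_base) blast

lemma zero_in_filt: "0 \<in> filt q"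
  unfolding filt_def by (rule fps_space.span_zero)

lemma add_in_filt: "u \<in> filt q \<Longrightarrow> v \<in> filt q \<Longrightarrow> u + v \<in> filt q"
  unfolding filt_def by (rule fps_space.span_add)

lemma diff_in_filt: "u \<in> filt q \<Longrightarrow> v \<in> filt q \<Longrightarrow> u - v \<in> filt q"
  unfolding filt_def by (rule fps_space.span_diff)

lemma sum_in_filt: "(\<And>i. i \<in> I \<Longrightarrow> u i \<in> filt q) \<Longrightarrow> (\<Sum>i\<in>I. u i) \<in> filt q"
  unfolding filt_def by (rule fps_space.span_sum)

lemma scale_in_filt: "u \<in> filt q \<Longrightarrow> fps_const c * u \<in> filt q"
  unfolding filt_def by (rule fps_space.span_scale)

lemma filt_induct [consumes 1, case_names zero step]:
  assumes "u \<in> filt q" "P 0"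
    and "\<And>c \<theta> u. q \<le> weight f \<theta> \<Longrightarrow> P u \<Longrightarrow> u \<in> filt q \<Longrightarrow> P (fps_const c * power_prod f \<theta> + u)"
  shows "P u"
proof -
  have "u \<in> fps_space.span {power_prod f \<theta> |\<theta>. q \<le> weight f \<theta>}"
    using assms(1) by (simp add: filt_def)
  then have "P u \<and> u \<in> filt q"
    by (induction rule: fps_space.span_induct_alt)
      (auto intro: assms zero_in_filt add_in_filt scale_in_filt power_prod_in_filt)
  then show ?thesis ..
qed

lemma filt_mult:
  assumes "u \<in> filt q"
  shows "power_prod f \<theta> * u \<in> filt (weight f \<theta> + q)"
  using assms
proof (induction rule: filt_induct)
  case zero
  then show ?case by (simp add: zero_in_filt)
next
  case (step c \<eta> u)
  have "power_prod f \<theta> * (fps_const c * power_prod f \<eta> + u) =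
      fps_const c * power_prod f (\<theta> + \<eta>) + power_prod f \<theta> * u"
    by (simp add: power_prod_add algebra_simps)
  then show ?case
    using step by (auto intro!: add_in_filt scale_in_filt power_prod_in_filt simp: weight_add)
qed

text \<open>If \<open>q\<close> is not a weight, every term has weight above \<open>q\<close> and
  contributes nothing to the coefficient at \<open>q\<close>.\<close>

lemma order_of_filt:
  assumes "u \<in> filt q" "fps_nth u q \<noteq> 0"
  shows "q \<in> range (weight f)"
proof (rule ccontr)
  assume q: "q \<notin> range (weight f)"
  have "fps_nth u q = 0"
    using assms(1)
  proof (induction rule: filt_induct)
    case (step c \<theta> u)
    with q have "q < weight f \<theta>"
      by (metis le_neq_implies_less rangeI)
    with step show ?case by (simp add: nth_power_prod_less_weight)
  qed simp
  with assms(2) show False by contradiction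
qed

section \<open>The filtration modulo x^(N+1), and its relation to the algebra\<close>

lemma filt_in_approx: "u \<in> filt q \<Longrightarrow> u \<in> approx q N"
  by (auto simp: approx_def)

lemma add_in_approx: "u \<in> approx q N \<Longrightarrow> v \<in> approx q N \<Longrightarrow> u + v \<in> approx q N"
proof -
  assume "u \<in> approx q N" "v \<in> approx q N"
  then obtain u' v' where "u' \<in> filt q" "v' \<in> filt q"
    "\<forall>n\<le>N. fps_nth u n = fps_nth u' n" "\<forall>n\<le>N. fps_nth v n = fps_nth v' n"
    by (auto simp: approx_def)
  then show "u + v \<in> approx q N"
    by (auto simp: approx_def intro!: bexI[of _ "u' + v'"] add_in_filt)
qed

lemma scale_in_approx: "u \<in> approx q N \<Longrightarrow> fps_const c * u \<in> approx q N"
proof -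
  assume "u \<in> approx q N"
  then obtain v where "v \<in> filt q" "\<forall>n\<le>N. fps_nth u n = fps_nth v n"
    by (auto simp: approx_def)
  then show "fps_const c * u \<in> approx q N"
    by (auto simp: approx_def intro!: bexI[of _ "fps_const c * v"] scale_in_filt)
qed

lemma approx_mult:
  assumes "u \<in> approx q N"
  shows "power_prod f \<theta> * u \<in> approx (weight f \<theta> + q) N"
proof -
  from assms obtain v where v: "v \<in> filt q" "\<And>n. n \<le> N \<Longrightarrow> fps_nth u n = fps_nth v n"
    by (auto simp: approx_def)
  \<comment> \<open>Coefficients of a product up to degree \<open>N\<close> involve only
    coefficients of the factors up to degree \<open>N\<close>, so no precision is lost.\<close>
  have "fps_nth (power_prod f \<theta> * u) n = fps_nth (power_prod f \<theta> * v) n" if "n \<le> N" for n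
    using that by (auto simp: fps_mult_nth v(2))
  with filt_mult[OF v(1)] show ?thesis
    by (auto simp: approx_def)
qed

text \<open>A polynomial is a power series of finite support. Collecting its coefficients in a
  \<open>poly_mapping\<close> merges repeated exponents.\<close>

lemma filt_zero_subset_algebra: "filt 0 \<subseteq> fps_algebra f"
proof
  fix u assume "u \<in> filt 0"
  then have "\<exists>P. u = (\<Sum>\<theta>\<in>Poly_Mapping.keys P. fps_const (Poly_Mapping.lookup P \<theta>) * power_prod f \<theta>)"
  proof (induction rule: filt_induct)
    case zero
    show ?case by (rule exI[of _ 0]) simp
  next
    case (step c \<eta> u)
    then obtain P where
      P: "u = (\<Sum>\<theta>\<in>Poly_Mapping.keys P. fps_const (Poly_Mapping.lookup P \<theta>) * power_prod f \<theta>)"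
      by blast
    have "(\<Sum>\<theta>\<in>Poly_Mapping.keys (Poly_Mapping.single \<eta> c + P).
          fps_const (Poly_Mapping.lookup (Poly_Mapping.single \<eta> c + P) \<theta>) * power_prod f \<theta>) =
        fps_const c * power_prod f \<eta> + u"
      by (subst setsum_keys_plus_distrib) (auto simp: algebra_simps P simp flip: fps_const_add)
    then show ?case by metis
  qed
  then obtain P where
    P: "u = (\<Sum>\<theta>\<in>Poly_Mapping.keys P. fps_const (Poly_Mapping.lookup P \<theta>) * power_prod f \<theta>)" ..
  have "((\<lambda>\<theta>. fps_const (Poly_Mapping.lookup P \<theta>) * power_prod f \<theta>) has_sum u) UNIV"
    using P by (intro has_sum_finite_neutralI[of "Poly_Mapping.keys P"]) (auto simp: in_keys_iff)
  then show "u \<in> fps_algebra f"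
    by (auto simp: fps_algebra_def)
qed

text \<open>In the x-adic topology, convergence means that some finite partial sum agrees with
  \<open>h\<close> up to degree \<open>N\<close>.\<close>

lemma algebra_subset_approx_zero: "fps_algebra f \<subseteq> approx 0 N"
proof
  fix h assume "h \<in> fps_algebra f"
  then obtain P where "((\<lambda>\<theta>. fps_const (P \<theta>) * power_prod f \<theta>) has_sum h) UNIV"
    by (auto simp: fps_algebra_def)
  then have "\<forall>\<^sub>F A in finite_subsets_at_top UNIV.
      \<forall>n\<le>N. fps_nth (\<Sum>\<theta>\<in>A. fps_const (P \<theta>) * power_prod f \<theta>) n = fps_nth h n"
    unfolding has_sum_def filterlim_iff
    using eventually_fps_nth_eq_nhds_fps_strong by blast
  then obtain A where "\<forall>n\<le>N. fps_nth (\<Sum>\<theta>\<in>A. fps_const (P \<theta>) * power_prod f \<theta>) n = fps_nth h n"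
    by (auto simp: eventually_finite_subsets_at_top)
  then have "\<forall>n\<le>N. fps_nth h n = fps_nth (\<Sum>\<theta>\<in>A. fps_const (P \<theta>) * power_prod f \<theta>) n"
    by simp
  moreover have "(\<Sum>\<theta>\<in>A. fps_const (P \<theta>) * power_prod f \<theta>) \<in> filt 0"
    by (intro sum_in_filt scale_in_filt power_prod_in_filt) simp
  ultimately show "h \<in> approx 0 N"
    unfolding approx_def by blast
qed

lemma range_weight_subset_order_set: "range (weight f) \<subseteq> order_set (fps_algebra f)"
proof
  fix n assume "n \<in> range (weight f)"
  then obtain \<theta> where \<theta>: "n = weight f \<theta>" by blast
  have "power_prod f \<theta> \<in> fps_algebra f"
    using filt_zero_subset_algebra power_prod_in_filt[of 0 \<theta>] by auto
  then show "n \<in> order_set (fps_algebra f)"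
    using power_prod_nonzero[of \<theta>]
    by (auto simp: order_set_def \<theta> simp flip: subdegree_power_prod intro: imageI)
qed


section \<open>The division process\<close>

text \<open>A nonzero \<open>g\<close> is a multiple of a power product of weight
  \<open>subdegree h\<close>. The case \<open>h = 0\<close> is separate because
  \<open>subdegree 0 = 0\<close>.\<close>

lemma division_step_in_filt:
  assumes "division_step f h g r" "h = 0 \<or> m \<le> subdegree h"
  shows "g \<in> filt m"
  using assms unfolding division_step_def
  by (auto split: if_splits simp flip: weight_def
      intro!: zero_in_filt scale_in_filt power_prod_in_filt)

text \<open>In both branches \<open>g + r\<close> has the same leading monomial as \<open>h\<close>.
  The bound includes the order itself, which makes the orders grow strictly.\<close>

lemma division_step_cancel:
  assumes step: "division_step f h g r" and h: "h \<noteq> 0" and n: "n \<le> subdegree h"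
  shows "fps_nth (h - g - r) n = 0"
proof (cases "subdegree h \<in> gen_submonoid (range (\<lambda>i. subdegree (f i)))")
  case True
  with step h obtain \<theta> c where r: "r = 0" and w: "weight f \<theta> = subdegree h"
    and lead: "lead_monom h = Polynomial.smult c (monom 1 (weight f \<theta>))"
    and g: "g = fps_const c * power_prod f \<theta>"
    by (auto simp: division_step_def weight_def[symmetric] power_prod_lead_monom)
  \<comment> \<open>The family is monic, so \<open>c\<close> can only be the leading coefficient of
    \<open>h\<close>.\<close>
  from lead w have "fps_nth h (subdegree h) = c"
    by (simp add: lead_monom_def smult_monom)
  with nth_power_prod_weight[of \<theta>] have top: "fps_nth (h - g - r) (subdegree h) = 0"
    by (simp add: r g w)
  have "fps_nth (h - g - r) n = 0" if "n < subdegree h"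
  proof -
    have "fps_nth h n = 0" using that by (rule nth_less_subdegree_zero)
    moreover have "fps_nth (power_prod f \<theta>) n = 0"
      using that by (intro nth_power_prod_less_weight) (simp only: w)
    ultimately show ?thesis by (simp add: r g)
  qed
  with top n show ?thesis by (cases "n = subdegree h") simp_all
next
  case False
  with step h have "g = 0" "r = fps_of_poly (lead_monom h)"
    by (auto simp: division_step_def)
  moreover have "fps_nth h n = 0" if "n \<noteq> subdegree h"
    using that n by (intro nth_less_subdegree_zero) simp
  ultimately show ?thesis
    by (cases "n = subdegree h") (simp_all add: lead_monom_def)
qed

text \<open>After enough steps only quotient terms are visible up to degree \<open>N\<close>, and
  their weights are orders of successive dividends, hence at least \<open>m\<close>.\<close>

lemma remainder_zero_in_approx:
  assumes "is_remainder f h 0" and h: "h = 0 \<or> m \<le> subdegree h"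
  shows "h \<in> approx m N"
proof -
  from assms(1) obtain hs gs rs where hs0: "hs 0 = h"
    and step: "\<And>k. division_step f (hs k) (gs (Suc k)) (rs (Suc k))"
    and hsSuc: "\<And>k. hs (Suc k) = hs k - gs (Suc k) - rs (Suc k)"
    and sums: "(\<lambda>k. rs (Suc k)) sums 0"
    by (auto simp: is_remainder_def)
  have order: "hs k = 0 \<or> m + k \<le> subdegree (hs k)" for k
  proof (induction k)
    case 0
    show ?case using h hs0 by simp
  next
    case (Suc k)
    show ?case
    proof (cases "hs k = 0")
      case True
      with step[of k] hsSuc[of k] show ?thesis by (simp add: division_step_def)
    next
      case False
      with Suc division_step_cancel[OF step[of k] False]
      have "fps_nth (hs (Suc k)) n = 0" if "n < m + Suc k" for n
        using that by (auto simp: hsSuc)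
      then show ?thesis by (metis subdegree_geI)
    qed
  qed
  have split: "h = (\<Sum>k<K. gs (Suc k)) + (\<Sum>k<K. rs (Suc k)) + hs K" for K
    by (induction K) (simp_all add: hs0 hsSuc algebra_simps)
  \<comment> \<open>The individual remainder terms are not shown to vanish; convergence to 0
    controls their partial sums.\<close>
  have "\<forall>\<^sub>F K in sequentially. \<forall>n\<le>N. fps_nth (\<Sum>k<K. rs (Suc k)) n = 0"
    using eventually_compose_filterlim[OF eventually_fps_nth_eq_nhds_fps_strong[of N "0 :: 'a fps"]
        sums[unfolded sums_def]]
    by (simp only: fps_zero_nth)
  then obtain K0 where K0: "\<And>K n. K0 \<le> K \<Longrightarrow> n \<le> N \<Longrightarrow> fps_nth (\<Sum>k<K. rs (Suc k)) n = 0"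
    by (auto simp: eventually_sequentially)
  \<comment> \<open>\<open>K0\<close> removes the remainder sum, and \<open>Suc N\<close> pushes the
    order of a nonzero \<open>hs K\<close> beyond \<open>N\<close>.\<close>
  define K where "K = max K0 (Suc N)"
  have "fps_nth h n = fps_nth (\<Sum>k<K. gs (Suc k)) n" if "n \<le> N" for n
  proof -
    have "fps_nth (hs K) n = 0"
      using order[of K] that by (auto simp: K_def intro: nth_less_subdegree_zero)
    moreover have "fps_nth (\<Sum>k<K. rs (Suc k)) n = 0"
      using K0[of K n] that by (simp add: K_def)
    ultimately show ?thesis
      by (subst split[of K]) (simp only: fps_add_nth add_0_right)
  qed
  moreover have "gs (Suc k) \<in> filt m" for k
    using order[of k] by (intro division_step_in_filt[OF step[of k]]) auto
  ultimately show ?thesis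
    unfolding approx_def using sum_in_filt[of "{..<K}" "\<lambda>k. gs (Suc k)" m] by blast
qed

text \<open>Every dividend stays a polynomial in the family, so its order, if it is nonzero, lies in
  the semigroup and the step leaves no remainder.\<close>

lemma remainder_eq_zero_if_basis:
  assumes basis: "is_basis f (fps_algebra f)" and h: "h \<in> filt 0" and rem: "is_remainder f h r"
  shows "r = 0"
proof -
  from rem obtain hs gs rs where hs0: "hs 0 = h"
    and step: "\<And>k. division_step f (hs k) (gs (Suc k)) (rs (Suc k))"
    and hsSuc: "\<And>k. hs (Suc k) = hs k - gs (Suc k) - rs (Suc k)"
    and sums: "(\<lambda>k. rs (Suc k)) sums r"
    by (auto simp: is_remainder_def)
  have rs0: "rs (Suc k) = 0" if "hs k \<in> filt 0" for k
  proof (cases "hs k = 0")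
    case True
    with step[of k] show ?thesis by (simp add: division_step_def)
  next
    case False
    with that have "subdegree (hs k) \<in> order_set (fps_algebra f)"
      using filt_zero_subset_algebra by (auto simp: order_set_def)
    with basis step[of k] False show ?thesis
      by (simp add: is_basis_def division_step_def)
  qed
  have "hs k \<in> filt 0" for k
  proof (induction k)
    case (Suc k)
    then show ?case
      using rs0[OF Suc] division_step_in_filt[OF step[of k], of 0]
      by (auto simp: hsSuc intro: diff_in_filt)
  qed (simp add: hs0 h)
  with rs0 sums have "(\<lambda>k. 0) sums r" by simp
  then show ?thesis by (simp add: sums_unique2)
qed


section \<open>Weighted evaluation of polynomials\<close>

text \<open>Projecting to weight \<open>q\<close> before substituting \<open>f\<close> allows a
  homogeneous relation to be expanded with inhomogeneous multipliers.\<close>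

definition weval :: "nat \<Rightarrow> (('n \<Rightarrow>\<^sub>0 nat) \<Rightarrow>\<^sub>0 'a) \<Rightarrow> 'a fps" where
  "weval q p = (\<Sum>\<theta>\<in>Poly_Mapping.keys p.
     if weight f \<theta> = q then fps_const (Poly_Mapping.lookup p \<theta>) * power_prod f \<theta> else 0)"

lemma weval_zero [simp]: "weval q 0 = 0"
  by (simp add: weval_def)

lemma weval_add: "weval q (p + p') = weval q p + weval q p'"
  unfolding weval_def
  by (rule setsum_keys_plus_distrib) (auto simp: algebra_simps simp flip: fps_const_add)

lemma weval_single:
  "weval q (Poly_Mapping.single \<theta> c) =
    (if weight f \<theta> = q then fps_const c * power_prod f \<theta> else 0)"
  by (auto simp: weval_def)

lemma weval_diff: "weval q (p - p') = weval q p - weval q p'"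
  using weval_add[of q "p - p'" p'] by simp

text \<open>By linearity of \<open>weval q\<close>, splitting the multipliers into monomials reduces
  the ideal to monomial multiples of generators.\<close>

lemma weval_ideal:
  assumes B: "\<And>b \<theta>. b \<in> B \<Longrightarrow> weval q (Poly_Mapping.single \<theta> 1 * b) \<in> approx (Suc q) N"
    and p: "p \<in> gen_ideal B"
  shows "weval q p \<in> approx (Suc q) N"
proof -
  interpret ideal: Modules.module "(*) :: (('n \<Rightarrow>\<^sub>0 nat) \<Rightarrow>\<^sub>0 'a) \<Rightarrow> _"
    by unfold_locales (simp_all add: algebra_simps)
  have scaled: "weval q (Poly_Mapping.single 0 c * p) = fps_const c * weval q p" for c p
  proof (induction p rule: poly_mapping_induct_single)
    case zero
    show ?case by simp
  next
    case (add \<theta> a p)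
    have "weval q (Poly_Mapping.single 0 c * Poly_Mapping.single \<theta> a) =
        fps_const c * weval q (Poly_Mapping.single \<theta> a)"
      by (simp add: mult_single weval_single flip: mult.assoc)
    with add show ?case by (simp only: distrib_left weval_add)
  qed
  have mult: "weval q (c * b) \<in> approx (Suc q) N" if "b \<in> B" for b c
  proof (induction c rule: poly_mapping_induct_single)
    case zero
    show ?case by (simp add: filt_in_approx zero_in_filt)
  next
    case (add \<theta> a p)
    have "Poly_Mapping.single \<theta> a = Poly_Mapping.single 0 a * Poly_Mapping.single \<theta> 1"
      by (simp add: mult_single)
    then have "weval q (Poly_Mapping.single \<theta> a * b) =
        fps_const a * weval q (Poly_Mapping.single \<theta> 1 * b)"
      by (simp only: mult.assoc scaled)
    with B[OF that] add show ?case
      by (simp add: distrib_right weval_add add_in_approx scale_in_approx)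
  qed
  from p show ?thesis
    unfolding gen_ideal_def
    by (induction rule: ideal.span_induct_alt)
      (simp_all add: filt_in_approx zero_in_filt weval_add add_in_approx mult)
qed

text \<open>Equal weights cancel the leading terms, so the difference \<open>s\<close> has order
  above the common weight. Division without remainder then rewrites \<open>s\<close> in terms of
  strictly larger weight.\<close>

lemma weval_binomial:
  assumes w: "weight f \<alpha> = weight f \<beta>"
    and rem: "is_remainder f (power_prod f \<alpha> - power_prod f \<beta>) 0"
  shows "weval q (Poly_Mapping.single \<theta> 1 * (Poly_Mapping.single \<alpha> 1 - Poly_Mapping.single \<beta> 1))
    \<in> approx (Suc q) N"
proof -
  define s where "s = power_prod f \<alpha> - power_prod f \<beta>"
  have "fps_nth s n = 0" if "n \<le> weight f \<alpha>" for n
    using that w nth_power_prod_weight[of \<alpha>] nth_power_prod_weight[of \<beta>]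
    by (cases "n = weight f \<alpha>") (auto simp: s_def nth_power_prod_less_weight)
  then have "s = 0 \<or> Suc (weight f \<alpha>) \<le> subdegree s"
    by (metis less_Suc_eq_le subdegree_geI)
  with rem have "s \<in> approx (Suc (weight f \<alpha>)) N"
    by (intro remainder_zero_in_approx) (simp_all add: s_def)
  from approx_mult[OF this, of \<theta>]
  have s: "power_prod f \<theta> * s \<in> approx (Suc (weight f \<theta> + weight f \<alpha>)) N" by simp
  \<comment> \<open>The multiplied binomial is homogeneous, so the projection keeps all of it or
    nothing.\<close>
  have "weval q (Poly_Mapping.single \<theta> 1 * (Poly_Mapping.single \<alpha> 1 - Poly_Mapping.single \<beta> 1)) =
      (if weight f \<theta> + weight f \<alpha> = q then power_prod f \<theta> * s else 0)"
    using w by (simp add: right_diff_distrib mult_single weval_diff weval_single weight_add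
        power_prod_add s_def)
  with s show ?thesis by (auto intro: filt_in_approx zero_in_filt)
qed

end

section \<open>The homomorphism on monomials and the splitting off of lowest weights\<close>

lemma poly_var_power: "poly_var i ^ n = Poly_Mapping.single (Poly_Mapping.single i n) 1"
  by (induction n) (simp_all add: poly_var_def mult_single flip: single_add)

lemma power_prod_poly_var:
  fixes \<theta> :: "'n::finite \<Rightarrow>\<^sub>0 nat"
  shows "power_prod poly_var \<theta> = (Poly_Mapping.single \<theta> 1 :: ('n \<Rightarrow>\<^sub>0 nat) \<Rightarrow>\<^sub>0 'a::field)"
proof -
  have "(\<Prod>i\<in>I. poly_var i ^ Poly_Mapping.lookup \<theta> i) = (Poly_Mapping.single
      (\<Sum>i\<in>I. Poly_Mapping.single i (Poly_Mapping.lookup \<theta> i)) 1 :: ('n \<Rightarrow>\<^sub>0 nat) \<Rightarrow>\<^sub>0 'a)"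
    if "finite I" for I
    using that by induction (simp_all add: poly_var_power mult_single)
  moreover have "(\<Sum>i\<in>UNIV. Poly_Mapping.single i (Poly_Mapping.lookup \<theta> i)) = \<theta>"
    by (rule poly_mapping_eqI) (simp add: lookup_sum lookup_single when_def)
  ultimately show ?thesis by (simp add: power_prod_def)
qed

context monic_family
begin

text \<open>The values on the variables determine the homomorphism. It turns weight into degree,
  since the leading monomials are monic.\<close>

lemma algebra_hom_single:
  assumes hom: "algebra_hom \<phi>" and var: "\<And>i. \<phi> (poly_var i) = lead_monom (f i)"
  shows "\<phi> (Poly_Mapping.single \<theta> c) = monom c (weight f \<theta>)"
proof -
  have mult: "\<phi> (p * q) = \<phi> p * \<phi> q" and one: "\<phi> 1 = 1" for p q
    using hom by (auto simp: algebra_hom_def)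
  have pow: "\<phi> (p ^ n) = \<phi> p ^ n" for p n
    by (induction n) (simp_all add: mult one)
  have prod: "\<phi> (\<Prod>i\<in>I. p i) = (\<Prod>i\<in>I. \<phi> (p i))" if "finite I" for I and p :: "'n \<Rightarrow> _"
    using that by induction (simp_all add: mult one)
  have "\<phi> (Poly_Mapping.single \<theta> 1) = power_prod (\<lambda>i. lead_monom (f i)) \<theta>"
    unfolding power_prod_poly_var[symmetric] power_prod_def by (simp add: prod pow var)
  moreover have "\<phi> (Poly_Mapping.single 0 c * Poly_Mapping.single \<theta> 1) =
      Polynomial.smult c (\<phi> (Poly_Mapping.single \<theta> 1))"
    using hom unfolding algebra_hom_def by blast
  ultimately show ?thesis
    by (simp add: mult_single power_prod_lead_monom smult_monom)
qed

text \<open>\<open>p\<close> collects the terms of weight exactly \<open>q\<close>. Each has leading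
  coefficient 1 at \<open>f\<close>, so the coefficients of \<open>p\<close> add up to that of
  \<open>u\<close> at \<open>q\<close>; if this is 0, \<open>p\<close> lies in the kernel.\<close>

lemma filt_split:
  assumes hom: "algebra_hom \<phi>" and var: "\<And>i. \<phi> (poly_var i) = lead_monom (f i)"
    and u: "u \<in> filt q"
  shows "\<exists>p. \<exists>v\<in>filt (Suc q). \<phi> p = monom (fps_nth u q) q \<and> u = weval q p + v"
  using u
proof (induction rule: filt_induct)
  case zero
  have "\<phi> 0 = 0"
    using algebra_hom_single[OF hom var, of 0 0] by simp
  then show ?case by (intro exI[of _ 0] bexI[of _ 0]) (simp_all add: zero_in_filt)
next
  case (step c \<theta> u)
  then obtain p v where v: "v \<in> filt (Suc q)" and p: "\<phi> p = monom (fps_nth u q) q"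
    and uv: "u = weval q p + v" by blast
  show ?case
  proof (cases "weight f \<theta> = q")
    case True
    have "\<phi> (Poly_Mapping.single \<theta> c + p) = monom (c + fps_nth u q) q"
      using hom p by (simp add: algebra_hom_def algebra_hom_single[OF hom var] True add_monom)
    with v uv True show ?thesis
      using nth_power_prod_weight[of \<theta>]
      by (intro exI[of _ "Poly_Mapping.single \<theta> c + p"] bexI[of _ v])
        (simp_all add: weval_add weval_single)
  next
    case False
    with step have "Suc q \<le> weight f \<theta>" by simp
    with v uv p show ?thesis
      by (intro exI[of _ p] bexI[of _ "fps_const c * power_prod f \<theta> + v"])
        (simp_all add: nth_power_prod_less_weight add_in_filt scale_in_filt power_prod_in_filt)
  qed
qed

end


section \<open>The basis criterion\<close>

theorem theorem2p9:
  fixes f :: "'n::finite \<Rightarrow> 'a::field fps"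
    and R :: "'a fps set"
    and \<phi> :: "(('n \<Rightarrow>\<^sub>0 nat) \<Rightarrow>\<^sub>0 'a) \<Rightarrow> 'a poly"
    and r :: nat
    and \<alpha> \<beta> :: "nat \<Rightarrow> ('n \<Rightarrow>\<^sub>0 nat)"
    and F :: "nat \<Rightarrow> (('n \<Rightarrow>\<^sub>0 nat) \<Rightarrow>\<^sub>0 'a)"
    and S Rem :: "nat \<Rightarrow> 'a fps"
  assumes monic: "\<And>i. monic_fps (f i)"
    and pos: "\<And>i. subdegree (f i) > 0"
    and R_eq: "R = fps_algebra f"
    and closure: "integral_closure (fps_to_fls ` R) (quotient_field R) = range fps_to_fls"
    and length: "module_length (ring_on R) (quotient_module ambient_module R) < \<infinity>"
    and hom: "algebra_hom \<phi>"
    and hom_var: "\<And>i. \<phi> (poly_var i) = lead_monom (f i)"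
    and F_eq: "\<And>i. i \<in> {1..r} \<Longrightarrow> F i = Poly_Mapping.single (\<alpha> i) 1 - Poly_Mapping.single (\<beta> i) 1"
    and F_gen: "gen_ideal (F ` {1..r}) = {p. \<phi> p = 0}"
    and S_eq: "\<And>i. i \<in> {1..r} \<Longrightarrow> S i = power_prod f (\<alpha> i) - power_prod f (\<beta> i)"
    and Rem: "\<And>i. i \<in> {1..r} \<Longrightarrow> is_remainder f (S i) (Rem i)"
  shows "is_basis f R \<longleftrightarrow> (\<forall>i\<in>{1..r}. Rem i = 0)"
proof -
  interpret monic_family f by unfold_locales (rule monic)
  interpret ideal: Modules.module "(*) :: (('n \<Rightarrow>\<^sub>0 nat) \<Rightarrow>\<^sub>0 'a) \<Rightarrow> _"
    by unfold_locales (simp_all add: algebra_simps)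
  show ?thesis
  proof
    assume basis: "is_basis f R"
    show "\<forall>i\<in>{1..r}. Rem i = 0"
    proof
      fix i assume i: "i \<in> {1..r}"
      have "S i \<in> filt 0"
        by (simp add: S_eq[OF i] diff_in_filt power_prod_in_filt)
      with basis Rem[OF i] show "Rem i = 0"
        by (auto simp: R_eq intro: remainder_eq_zero_if_basis)
    qed
  next
    assume Rem_zero: "\<forall>i\<in>{1..r}. Rem i = 0"
    have weights: "weight f (\<alpha> i) = weight f (\<beta> i)" if i: "i \<in> {1..r}" for i
    proof -
      have "F i \<in> gen_ideal (F ` {1..r})"
        unfolding gen_ideal_def using i by (intro ideal.span_base) blast
      then have "\<phi> (F i) = 0" using F_gen by blast
      \<comment> \<open>Adding back the second monomial needs only additivity and shows that both
        monomials have the same image.\<close>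
      then have "\<phi> (F i + Poly_Mapping.single (\<beta> i) 1) = \<phi> (Poly_Mapping.single (\<beta> i) 1)"
        using hom by (simp add: algebra_hom_def)
      then have "monom (1::'a) (weight f (\<alpha> i)) = monom 1 (weight f (\<beta> i))"
        by (simp add: F_eq[OF i] algebra_hom_single[OF hom hom_var])
      then show ?thesis by (simp add: monom_eq_iff')
    qed
    have kernel: "weval q p \<in> approx (Suc q) N" if "\<phi> p = 0" for p q N
    proof (rule weval_ideal)
      show "p \<in> gen_ideal (F ` {1..r})" using F_gen that by blast
      fix b \<theta> assume "b \<in> F ` {1..r}"
      then obtain i where i: "i \<in> {1..r}" "b = F i" by blast
      then show "weval q (Poly_Mapping.single \<theta> 1 * b) \<in> approx (Suc q) N"
        using Rem[OF i(1)] Rem_zero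
        by (auto simp: F_eq S_eq intro!: weval_binomial weights)
    qed
    \<comment> \<open>Vanishing at \<open>q\<close> makes the lowest component a relation, which
      \<open>kernel\<close> moves to higher weight.\<close>
    have raise: "u \<in> approx (Suc q) N" if u: "u \<in> filt q" "fps_nth u q = 0" for u q N
    proof -
      obtain p v where "v \<in> filt (Suc q)" "\<phi> p = 0" "u = weval q p + v"
        using filt_split[OF hom hom_var u(1)] u(2) by auto
      then show ?thesis by (simp add: add_in_approx kernel filt_in_approx)
    qed
    have "order_set R \<subseteq> range (weight f)"
    proof
      fix p assume "p \<in> order_set R"
      then obtain h where h: "h \<in> R" "h \<noteq> 0" and p: "p = subdegree h"
        by (auto simp: order_set_def)
      \<comment> \<open>The precision stays fixed at \<open>p\<close> while \<open>q\<close> climbs;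
        below \<open>p\<close> the coefficients of \<open>h\<close> vanish, so \<open>raise\<close>
        applies to each approximant.\<close>
      have "h \<in> approx q p" if "q \<le> p" for q
        using that
      proof (induction q)
        case 0
        show ?case using h(1) algebra_subset_approx_zero by (auto simp: R_eq)
      next
        case (Suc q)
        then obtain u where u: "u \<in> filt q" "\<And>n. n \<le> p \<Longrightarrow> fps_nth h n = fps_nth u n"
          by (auto simp: approx_def)
        have "fps_nth u q = 0"
          using Suc.prems u(2)[of q] nth_less_subdegree_zero[of q h] by (simp add: p)
        from raise[OF u(1) this, of p] u(2) show ?case
          by (auto simp: approx_def)
      qed
      \<comment> \<open>At \<open>q = p\<close> the approximant has the nonzero leading coefficient
        of \<open>h\<close>, which forces a term of weight exactly \<open>p\<close>.\<close>
      from this[of p] obtain u where "u \<in> filt p" "fps_nth h p = fps_nth u p"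
        by (auto simp: approx_def)
      with h(2) show "p \<in> range (weight f)"
        by (intro order_of_filt[of u]) (auto simp: p)
    qed
    with range_weight_subset_order_set show "is_basis f R"
      unfolding is_basis_def gen_submonoid_eq_range_weight R_eq by (rule subset_antisym[rotated])
  qed
qed

end
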